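(* Let $s<0$ and let $T$ be a positive number. Then there does not exist a space $X_T$ continuously embedded in $C([-T,T];H^s_{per})$ for which there exists $c_0>0$ satisfying $$\|S(t)\phi\|_{X_T}\le c_0\|\phi\|_{H^s_{per}}\qquad\forall \phi\in H^s_{per}$$ and $$\left\|\int_0^tS(t-\tau)\Lambda[u_x(\tau)u(\tau)]\,d\tau\right\|_{X_T}\le c_0\|u\|_{X_T}^2\qquad\forall u\in X_T.$$
   Context: $H^s_{per}=H^s_{per}([-\pi,\pi])$ is the Sobolev space of $2\pi$-periodic distributions with norm $\|f\|_{H^s_{per}}^2=2\pi\sum_{n\in\mathbb{Z}}(1+|n|^2)^s|\widehat f(n)|^2$, where $\widehat f(n)=\frac1{2\pi}\int_{-\pi}^{\pi}f(x)e^{-inx}dx$. The operators $S(t)$ (the linear group of the regularized Benjamin-Ono equation $u_t+u_x+uu_x+\mathcal{H}u_{xt}=0$, with $\mathcal{H}$ the Hilbert transform $\widehat{\mathcal{H}f}(n)=-i\,\mathrm{sgn}(n)\widehat f(n)$) and $\Lambda$ are defined by $$\widehat{S(t)\phi}(n)=e^{-\frac{in}{1+|n|}t}\,\widehat\phi(n),\qquad \widehat{\Lambda u}(n)=(1+|n|)^{-1}\widehat u(n),\qquad n\in\mathbb{Z}.$$ "Space" means a normed space of functions of $(t,x)$, with norm $\|\cdot\|_{X_T}$; the expressions $S(t)\phi$ and $\int_0^tS(t-\tau)\Lambda[u_xu]d\tau$ are regarded as functions of $t\in[-T,T]$ with values in functions of $x$, and the inequalities include the assertion that they belong to $X_T$.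 *)

theory Defs
  imports "HOL-Analysis.Analysis"
begin

definition vderiv :: "(real \<Rightarrow> complex) \<Rightarrow> real \<Rightarrow> complex" where
  "vderiv \<psi> = (\<lambda>x. vector_derivative \<psi> (at x))"

definition periodic_test_functions :: "(real \<Rightarrow> complex) set" where
  "periodic_test_functions =
     {\<psi>. (\<forall>x. \<psi> (x + 2 * pi) = \<psi> x) \<and> (\<forall>k x. ((vderiv ^^ k) \<psi>) differentiable (at x))}"

definition test_seminorm :: "nat \<Rightarrow> (real \<Rightarrow> complex) \<Rightarrow> real" where
  "test_seminorm k \<psi> = (SUP x\<in>{-pi..pi}. cmod ((vderiv ^^ k) \<psi> x))"

text \<open>A periodic distribution is a continuous complex-linear functional on the Frechet space of
  smooth \<open>2\<pi>\<close>-periodic functions. The value 0 is prescribed on functions that are not test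
  functions, so that equality of functionals is equality of distributions.\<close>

definition is_periodic_distribution :: "((real \<Rightarrow> complex) \<Rightarrow> complex) \<Rightarrow> bool" where
  "is_periodic_distribution F \<longleftrightarrow>
     (\<forall>\<psi>. \<psi> \<notin> periodic_test_functions \<longrightarrow> F \<psi> = 0) \<and>
     (\<forall>\<psi>\<in>periodic_test_functions. \<forall>\<eta>\<in>periodic_test_functions. \<forall>a b.
        F (\<lambda>x. a * \<psi> x + b * \<eta> x) = a * F \<psi> + b * F \<eta>) \<and>
     (\<exists>C m. \<forall>\<psi>\<in>periodic_test_functions. cmod (F \<psi>) \<le> C * (\<Sum>k\<le>m. test_seminorm k \<psi>))"

lemma test_seminorm_nonneg:
  assumes "\<psi> \<in> periodic_test_functions"
  shows "0 \<le> test_seminorm k \<psi>"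
proof -
  have "\<And>x. ((vderiv ^^ k) \<psi>) differentiable (at x)"
    using assms by (auto simp: periodic_test_functions_def)
  then have "continuous_on {-pi..pi} (\<lambda>x. cmod ((vderiv ^^ k) \<psi> x))"
    by (intro continuous_on_norm continuous_at_imp_continuous_on)
       (auto dest: differentiable_imp_continuous_within)
  then have "compact ((\<lambda>x. cmod ((vderiv ^^ k) \<psi> x)) ` {-pi..pi})"
    by (intro compact_continuous_image) auto
  then have "bdd_above ((\<lambda>x. cmod ((vderiv ^^ k) \<psi> x)) ` {-pi..pi})"
    by (intro bounded_imp_bdd_above compact_imp_bounded)
  then have "cmod ((vderiv ^^ k) \<psi> 0) \<le> test_seminorm k \<psi>"
    unfolding test_seminorm_def by (intro cSUP_upper) auto
  then show ?thesis using norm_ge_zero order_trans by blast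
qed

lemma is_periodic_distribution_zero: "is_periodic_distribution (\<lambda>\<psi>. 0)"
  unfolding is_periodic_distribution_def by (auto intro!: exI[of _ 0])

lemma is_periodic_distribution_add:
  assumes F: "is_periodic_distribution F" and G: "is_periodic_distribution G"
  shows "is_periodic_distribution (\<lambda>\<psi>. F \<psi> + G \<psi>)"
proof -
  obtain C m where C: "\<And>\<psi>. \<psi> \<in> periodic_test_functions \<Longrightarrow>
      cmod (F \<psi>) \<le> C * (\<Sum>k\<le>m. test_seminorm k \<psi>)"
    using F unfolding is_periodic_distribution_def by blast
  obtain D n where D: "\<And>\<psi>. \<psi> \<in> periodic_test_functions \<Longrightarrow>
      cmod (G \<psi>) \<le> D * (\<Sum>k\<le>n. test_seminorm k \<psi>)"
    using G unfolding is_periodic_distribution_def by blast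
  have "cmod (F \<psi> + G \<psi>) \<le> (\<bar>C\<bar> + \<bar>D\<bar>) * (\<Sum>k\<le>max m n. test_seminorm k \<psi>)"
    if \<psi>: "\<psi> \<in> periodic_test_functions" for \<psi>
  proof -
    have mono: "(\<Sum>k\<le>j. test_seminorm k \<psi>) \<le> (\<Sum>k\<le>max m n. test_seminorm k \<psi>)"
      if "j \<le> max m n" for j
      using that by (intro sum_mono2) (auto intro: test_seminorm_nonneg[OF \<psi>])
    have nn: "0 \<le> (\<Sum>k\<le>j. test_seminorm k \<psi>)" for j
      by (intro sum_nonneg) (auto intro: test_seminorm_nonneg[OF \<psi>])
    have "C * (\<Sum>k\<le>m. test_seminorm k \<psi>) \<le> \<bar>C\<bar> * (\<Sum>k\<le>max m n. test_seminorm k \<psi>)"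
      by (intro mult_mono mono nn) auto
    moreover have "D * (\<Sum>k\<le>n. test_seminorm k \<psi>) \<le> \<bar>D\<bar> * (\<Sum>k\<le>max m n. test_seminorm k \<psi>)"
      by (intro mult_mono mono nn) auto
    ultimately show ?thesis
      using C[OF \<psi>] D[OF \<psi>] norm_triangle_ineq[of "F \<psi>" "G \<psi>"] by (simp add: distrib_right)
  qed
  then have "\<exists>C m. \<forall>\<psi>\<in>periodic_test_functions.
      cmod (F \<psi> + G \<psi>) \<le> C * (\<Sum>k\<le>m. test_seminorm k \<psi>)"
    by blast
  then show ?thesis
    using F G unfolding is_periodic_distribution_def by (simp add: algebra_simps)
qed

lemma is_periodic_distribution_scale:
  assumes F: "is_periodic_distribution F"
  shows "is_periodic_distribution (\<lambda>\<psi>. c * F \<psi>)"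
proof -
  obtain C m where C: "\<And>\<psi>. \<psi> \<in> periodic_test_functions \<Longrightarrow>
      cmod (F \<psi>) \<le> C * (\<Sum>k\<le>m. test_seminorm k \<psi>)"
    using F unfolding is_periodic_distribution_def by blast
  have "cmod (c * F \<psi>) \<le> (cmod c * C) * (\<Sum>k\<le>m. test_seminorm k \<psi>)"
    if "\<psi> \<in> periodic_test_functions" for \<psi>
    using mult_left_mono[OF C[OF that] norm_ge_zero[of c]] by (simp add: norm_mult mult.assoc)
  then have "\<exists>C m. \<forall>\<psi>\<in>periodic_test_functions.
      cmod (c * F \<psi>) \<le> C * (\<Sum>k\<le>m. test_seminorm k \<psi>)"
    by blast
  then show ?thesis
    using F unfolding is_periodic_distribution_def by (simp add: algebra_simps)
qed

lemma vderiv_test_function: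
  assumes "\<psi> \<in> periodic_test_functions"
  shows "vderiv \<psi> \<in> periodic_test_functions"
proof -
  have per: "\<And>x. \<psi> (x + 2 * pi) = \<psi> x"
    and diff: "\<And>k x. ((vderiv ^^ k) \<psi>) differentiable (at x)"
    using assms by (auto simp: periodic_test_functions_def)
  have "vderiv \<psi> (x + 2 * pi) = vderiv \<psi> x" for x
  proof -
    have "\<psi> differentiable (at (x + 2 * pi))"
      using diff[of 0] by simp
    then have "(\<psi> has_vector_derivative vderiv \<psi> (x + 2 * pi)) (at (x + 2 * pi))"
      by (simp add: vderiv_def vector_derivative_works[symmetric])
    then have "(\<psi> \<circ> (\<lambda>y. y + 2 * pi) has_vector_derivative 1 *\<^sub>R vderiv \<psi> (x + 2 * pi)) (at x)"
      by (intro vector_diff_chain_at) (auto intro!: derivative_eq_intros)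
    moreover have "\<psi> \<circ> (\<lambda>y. y + 2 * pi) = \<psi>"
      using per by (auto simp: o_def)
    ultimately show ?thesis
      unfolding vderiv_def by (metis scaleR_one vector_derivative_at)
  qed
  moreover have "((vderiv ^^ k) (vderiv \<psi>)) differentiable (at x)" for k x
    using diff[of "Suc k" x] by (simp add: funpow_swap1)
  ultimately show ?thesis
    by (auto simp: periodic_test_functions_def)
qed

lemma vderiv_linear:
  assumes "\<psi> \<in> periodic_test_functions" "\<eta> \<in> periodic_test_functions"
  shows "vderiv (\<lambda>x. a * \<psi> x + b * \<eta> x) = (\<lambda>x. a * vderiv \<psi> x + b * vderiv \<eta> x)"
proof
  fix x
  have "\<psi> differentiable (at x)" "\<eta> differentiable (at x)"
    using assms by (auto simp: periodic_test_functions_def dest: spec[of _ 0])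
  then have "(\<psi> has_vector_derivative vderiv \<psi> x) (at x)"
    "(\<eta> has_vector_derivative vderiv \<eta> x) (at x)"
    by (simp_all add: vderiv_def vector_derivative_works[symmetric])
  then have "((\<lambda>x. a * \<psi> x + b * \<eta> x) has_vector_derivative
      (a * vderiv \<psi> x + b * vderiv \<eta> x)) (at x)"
    by (intro has_vector_derivative_add has_vector_derivative_mult_right)
  then show "vderiv (\<lambda>x. a * \<psi> x + b * \<eta> x) x = a * vderiv \<psi> x + b * vderiv \<eta> x"
    by (simp add: vderiv_def vector_derivative_at)
qed

lemma periodic_test_functions_linear:
  assumes "\<psi> \<in> periodic_test_functions" "\<eta> \<in> periodic_test_functions"
  shows "(\<lambda>x. a * \<psi> x + b * \<eta> x) \<in> periodic_test_functions"
proof -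
  have iter: "(vderiv ^^ k) \<phi> \<in> periodic_test_functions"
    if "\<phi> \<in> periodic_test_functions" for k \<phi>
    using that by (induction k) (auto intro: vderiv_test_function)
  have eq: "(vderiv ^^ k) (\<lambda>x. a * \<psi> x + b * \<eta> x) =
      (\<lambda>x. a * (vderiv ^^ k) \<psi> x + b * (vderiv ^^ k) \<eta> x)" for k
    by (induction k) (auto simp: vderiv_linear[OF iter iter, OF assms])
  have "(vderiv ^^ k) \<psi> differentiable (at x)" "(vderiv ^^ k) \<eta> differentiable (at x)" for k x
    using assms by (auto simp: periodic_test_functions_def)
  then have "((vderiv ^^ k) (\<lambda>x. a * \<psi> x + b * \<eta> x)) differentiable (at x)" for k x
    unfolding eq by (intro differentiable_add differentiable_mult differentiable_const)
  then show ?thesis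
    using assms by (auto simp: periodic_test_functions_def)
qed

lemma is_periodic_distribution_deriv:
  assumes F: "is_periodic_distribution F"
  shows "is_periodic_distribution
    (\<lambda>\<psi>. if \<psi> \<in> periodic_test_functions then - F (vderiv \<psi>) else 0)"
proof -
  obtain C m where C: "\<And>\<psi>. \<psi> \<in> periodic_test_functions \<Longrightarrow>
      cmod (F \<psi>) \<le> C * (\<Sum>k\<le>m. test_seminorm k \<psi>)"
    using F unfolding is_periodic_distribution_def by blast
  have lin: "F (\<lambda>x. a * \<psi> x + b * \<eta> x) = a * F \<psi> + b * F \<eta>"
    if "\<psi> \<in> periodic_test_functions" "\<eta> \<in> periodic_test_functions" for \<psi> \<eta> a b
    using F that unfolding is_periodic_distribution_def by blast
  have "cmod (F (vderiv \<psi>)) \<le> \<bar>C\<bar> * (\<Sum>k\<le>Suc m. test_seminorm k \<psi>)"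
    if \<psi>: "\<psi> \<in> periodic_test_functions" for \<psi>
  proof -
    have shift: "test_seminorm k (vderiv \<psi>) = test_seminorm (Suc k) \<psi>" for k
      by (simp add: test_seminorm_def funpow_swap1)
    have "(\<Sum>k\<le>m. test_seminorm k (vderiv \<psi>)) \<le> (\<Sum>k\<le>Suc m. test_seminorm k \<psi>)"
      using test_seminorm_nonneg[OF \<psi>, of 0] by (simp add: shift sum.atMost_Suc_shift del: sum.atMost_Suc)
    moreover have "0 \<le> (\<Sum>k\<le>m. test_seminorm k (vderiv \<psi>))"
      by (intro sum_nonneg) (auto intro: test_seminorm_nonneg vderiv_test_function[OF \<psi>])
    ultimately have "C * (\<Sum>k\<le>m. test_seminorm k (vderiv \<psi>)) \<le>
        \<bar>C\<bar> * (\<Sum>k\<le>Suc m. test_seminorm k \<psi>)"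
      by (intro mult_mono) auto
    then show ?thesis
      using C[OF vderiv_test_function[OF \<psi>]] by linarith
  qed
  then have "\<exists>C m. \<forall>\<psi>\<in>periodic_test_functions.
      cmod (F (vderiv \<psi>)) \<le> C * (\<Sum>k\<le>m. test_seminorm k \<psi>)"
    by blast
  then show ?thesis
    unfolding is_periodic_distribution_def
    by (simp add: vderiv_linear lin vderiv_test_function periodic_test_functions_linear)
qed

typedef periodic_distribution = "{F. is_periodic_distribution F}"
  morphisms pairing Abs_periodic_distribution
  using is_periodic_distribution_zero by blast

setup_lifting type_definition_periodic_distribution

instantiation periodic_distribution :: real_vector
begin

lift_definition zero_periodic_distribution :: periodic_distribution is "\<lambda>\<psi>. 0"
  by (rule is_periodic_distribution_zero)

lift_definition plus_periodic_distribution ::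
  "periodic_distribution \<Rightarrow> periodic_distribution \<Rightarrow> periodic_distribution"
  is "\<lambda>F G \<psi>. F \<psi> + G \<psi>"
  by (rule is_periodic_distribution_add)

lift_definition uminus_periodic_distribution :: "periodic_distribution \<Rightarrow> periodic_distribution"
  is "\<lambda>F \<psi>. - F \<psi>"
  using is_periodic_distribution_scale[of _ "-1"] by simp

lift_definition minus_periodic_distribution ::
  "periodic_distribution \<Rightarrow> periodic_distribution \<Rightarrow> periodic_distribution"
  is "\<lambda>F G \<psi>. F \<psi> - G \<psi>"
  using is_periodic_distribution_add is_periodic_distribution_scale[of _ "-1"] by fastforce

lift_definition scaleR_periodic_distribution ::
  "real \<Rightarrow> periodic_distribution \<Rightarrow> periodic_distribution"
  is "\<lambda>r F \<psi>. complex_of_real r * F \<psi>"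
  by (rule is_periodic_distribution_scale)

instance
  by standard (transfer; simp add: algebra_simps)+

end

lift_definition distr_deriv :: "periodic_distribution \<Rightarrow> periodic_distribution"
  is "\<lambda>F \<psi>. if \<psi> \<in> periodic_test_functions then - F (vderiv \<psi>) else 0"
  by (rule is_periodic_distribution_deriv)

text \<open>A periodic function \<open>f\<close> acts by \<open>\<psi> \<mapsto> \<integral> f \<psi>\<close> over a period; for it the following is
  \<open>1/(2\<pi>) \<integral> f(x) exp(-inx) dx\<close>.\<close>

definition fourier :: "periodic_distribution \<Rightarrow> int \<Rightarrow> complex" where
  "fourier f n = pairing f (\<lambda>x. exp (- (\<i> * of_int n * of_real x))) / (2 * of_real pi)"

definition Hs :: "real \<Rightarrow> periodic_distribution set" where
  "Hs s = {f. (\<lambda>n::int. (1 + \<bar>real_of_int n\<bar>\<^sup>2) powr s * (cmod (fourier f n))\<^sup>2) summable_on UNIV}"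

definition Hs_norm :: "real \<Rightarrow> periodic_distribution \<Rightarrow> real" where
  "Hs_norm s f =
     sqrt (2 * pi * (\<Sum>\<^sub>\<infinity>n::int. (1 + \<bar>real_of_int n\<bar>\<^sup>2) powr s * (cmod (fourier f n))\<^sup>2))"

text \<open>Functions on \<open>[-T,T]\<close> are represented by their extension by 0 to the real line.\<close>

definition vanishes_outside :: "real \<Rightarrow> (real \<Rightarrow> 'a::zero) \<Rightarrow> bool" where
  "vanishes_outside T u \<longleftrightarrow> (\<forall>t. t \<notin> {-T..T} \<longrightarrow> u t = 0)"

definition restrict_time :: "real \<Rightarrow> (real \<Rightarrow> 'a::zero) \<Rightarrow> real \<Rightarrow> 'a" where
  "restrict_time T u = (\<lambda>t. if t \<in> {-T..T} then u t else 0)"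

definition C_Hs :: "real \<Rightarrow> real \<Rightarrow> (real \<Rightarrow> periodic_distribution) set" where
  "C_Hs T s = {u. vanishes_outside T u \<and> (\<forall>t\<in>{-T..T}. u t \<in> Hs s) \<and>
     (\<forall>t\<in>{-T..T}. ((\<lambda>\<tau>. Hs_norm s (u \<tau> - u t)) \<longlongrightarrow> 0) (at t within {-T..T}))}"

text \<open>A periodic distribution is determined by its Fourier coefficients, and one with the required
  coefficients exists whenever \<open>m\<close> has at most polynomial growth.\<close>

definition fourier_multiplier :: "(int \<Rightarrow> complex) \<Rightarrow> periodic_distribution \<Rightarrow> periodic_distribution" where
  "fourier_multiplier m f = (THE g. \<forall>n. fourier g n = m n * fourier f n)"

definition S :: "real \<Rightarrow> periodic_distribution \<Rightarrow> periodic_distribution" where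
  "S t = fourier_multiplier (\<lambda>n. exp (- (\<i> * of_int n / of_int (1 + \<bar>n\<bar>)) * of_real t))"

definition \<Lambda> :: "periodic_distribution \<Rightarrow> periodic_distribution" where
  "\<Lambda> = fourier_multiplier (\<lambda>n. inverse (of_int (1 + \<bar>n\<bar>)))"

text \<open>The product of two periodic distributions is only partially defined: it exists, with value
  \<open>h\<close>, when for every frequency the convolution of the Fourier coefficients converges
  unconditionally (equivalently, absolutely) to the coefficient of \<open>h\<close>.\<close>

definition is_product ::
  "periodic_distribution \<Rightarrow> periodic_distribution \<Rightarrow> periodic_distribution \<Rightarrow> bool" where
  "is_product f g h \<longleftrightarrow>
     (\<forall>n. ((\<lambda>k. fourier f k * fourier g (n - k)) has_sum fourier h n) UNIV)"

text \<open>The distribution-valued integral is the weak one, tested against smooth functions; it is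
  oriented, so that negative \<open>t\<close> are included.\<close>

definition is_integral ::
  "real \<Rightarrow> real \<Rightarrow> (real \<Rightarrow> periodic_distribution) \<Rightarrow> periodic_distribution \<Rightarrow> bool" where
  "is_integral a b F v \<longleftrightarrow> (\<forall>\<psi>\<in>periodic_test_functions.
     interval_lebesgue_integrable lborel (ereal a) (ereal b) (\<lambda>\<tau>. pairing (F \<tau>) \<psi>) \<and>
     (LBINT \<tau>=ereal a..ereal b. pairing (F \<tau>) \<psi>) = pairing v \<psi>)"

text \<open>\<open>v(t) = \<integral>\<^sub>0\<^sup>t S(t-\<tau>) \<Lambda>[u\<^sub>x(\<tau>) u(\<tau>)] d\<tau>\<close> on \<open>[-T,T]\<close>, including that the right-hand
  side is meaningful. At most one \<open>v\<close> satisfies this for given \<open>u\<close>; none does if a product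
  \<open>u\<^sub>x(\<tau>) u(\<tau>)\<close> is undefined, which can happen for \<open>u(\<tau>)\<close> of negative regularity.\<close>

definition is_duhamel ::
  "real \<Rightarrow> (real \<Rightarrow> periodic_distribution) \<Rightarrow> (real \<Rightarrow> periodic_distribution) \<Rightarrow> bool" where
  "is_duhamel T u v \<longleftrightarrow> vanishes_outside T v \<and>
     (\<exists>w. (\<forall>\<tau>\<in>{-T..T}. is_product (distr_deriv (u \<tau>)) (u \<tau>) (w \<tau>)) \<and>
          (\<forall>t\<in>{-T..T}. is_integral 0 t (\<lambda>\<tau>. S (t - \<tau>) (\<Lambda> (w \<tau>))) (v t)))"

definition normed_function_space ::
  "(real \<Rightarrow> 'a::real_vector) set \<Rightarrow> ((real \<Rightarrow> 'a) \<Rightarrow> real) \<Rightarrow> bool" where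
  "normed_function_space X N \<longleftrightarrow>
     (\<lambda>t. 0) \<in> X \<and>
     (\<forall>u\<in>X. \<forall>v\<in>X. (\<lambda>t. u t + v t) \<in> X) \<and>
     (\<forall>a. \<forall>u\<in>X. (\<lambda>t. a *\<^sub>R u t) \<in> X) \<and>
     (\<forall>u\<in>X. 0 \<le> N u) \<and>
     (\<forall>u\<in>X. N u = 0 \<longleftrightarrow> u = (\<lambda>t. 0)) \<and>
     (\<forall>u\<in>X. \<forall>v\<in>X. N (\<lambda>t. u t + v t) \<le> N u + N v) \<and>
     (\<forall>a. \<forall>u\<in>X. N (\<lambda>t. a *\<^sub>R u t) = \<bar>a\<bar> * N u)"

definition continuously_embedded_in_C_Hs ::
  "real \<Rightarrow> real \<Rightarrow> (real \<Rightarrow> periodic_distribution) set \<Rightarrow>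
    ((real \<Rightarrow> periodic_distribution) \<Rightarrow> real) \<Rightarrow> bool" where
  "continuously_embedded_in_C_Hs T s X N \<longleftrightarrow> X \<subseteq> C_Hs T s \<and>
     (\<exists>C. \<forall>u\<in>X. \<forall>t\<in>{-T..T}. Hs_norm s (u t) \<le> C * N u)"

end

theory Submission
  imports Defs
begin

text \<open>Take \<open>\<phi> = exp(inx)\<close>. Then \<open>S(t)\<phi>\<close> and its Duhamel integral \<open>v(t)\<close> each consist of a single
  mode, at the frequencies \<open>n\<close> and \<open>2n\<close>. The resonance function \<open>2p(n) - p(2n)\<close> with
  \<open>p(n) = n/(1+|n|)\<close> lies in \<open>[1/3, 1]\<close> for \<open>n \<ge> 1\<close>, so for fixed small \<open>t > 0\<close> the coefficient of
  \<open>v(t)\<close> stays away from 0. The estimates would therefore give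
  \<open>n\<^sup>s \<lesssim> \<parallel>v(t)\<parallel> \<lesssim> \<parallel>\<phi>\<parallel>\<^sup>2 \<lesssim> n\<^sup>2\<^sup>s\<close>, which fails for \<open>s < 0\<close> as \<open>n \<rightarrow> \<infinity>\<close>.
  Evaluating \<open>S\<close> and \<open>\<Lambda>\<close> on a mode requires that Fourier coefficients determine a periodic
  distribution; this holds because, by Stone--Weierstrass, every test function is a limit of
  trigonometric polynomials uniformly with any number of derivatives.\<close>

subsection \<open>Trigonometric polynomials\<close>

definition character :: "int \<Rightarrow> real \<Rightarrow> complex" where
  "character n x = exp (\<i> * of_int n * of_real x)"

lemma character_add: "character (m + n) x = character m x * character n x"
  by (simp add: character_def exp_add [symmetric] algebra_simps)

lemma character_zero [simp]: "character 0 x = 1"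
  by (simp add: character_def)

lemma character_has_vector_derivative:
  "(character n has_vector_derivative \<i> * of_int n * character n x) (at x)"
  unfolding character_def
  by (auto intro!: derivative_eq_intros has_vector_derivative_real_field simp: mult_ac)

lemma vderiv_eqI:
  assumes "\<And>x. (f has_vector_derivative g x) (at x)"
  shows "vderiv f = g"
  unfolding vderiv_def using assms by (auto intro: vector_derivative_at)

lemma test_function_has_vector_derivative:
  assumes "\<psi> \<in> periodic_test_functions"
  shows "(\<psi> has_vector_derivative vderiv \<psi> x) (at x)"
proof -
  have "((vderiv ^^ 0) \<psi>) differentiable (at x)"
    using assms unfolding periodic_test_functions_def by blast
  then show ?thesis
    by (simp add: vderiv_def vector_derivative_works)
qed

lemma character_test_function: "(\<lambda>x. c * character n x) \<in> periodic_test_functions"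
proof -
  have *: "((\<lambda>x. a * character n x) has_vector_derivative a * (\<i> * of_int n * character n x)) (at x)"
    for a x
    by (intro has_vector_derivative_mult_right character_has_vector_derivative)
  have diff: "(\<lambda>x. a * character n x) differentiable (at x)" for a x
    by (rule differentiableI_vector [OF *])
  have iter: "(vderiv ^^ k) (\<lambda>x. c * character n x) = (\<lambda>x. c * (\<i> * of_int n) ^ k * character n x)" for k
  proof (induction k)
    case (Suc k)
    then show ?case
      using vderiv_eqI [OF *, of "c * (\<i> * of_int n) ^ k"]
      by (simp only: funpow.simps o_def power_Suc2 mult.assoc)
  qed simp
  have "character n (x + 2 * pi) = character n x" for x
    unfolding character_def using exp_integer_2pi [of "of_int n"]
    by (simp add: algebra_simps exp_add)
  then show ?thesis
    unfolding periodic_test_functions_def using diff by (auto simp only: iter mem_Collect_eq)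
qed

lemma periodic_test_functions_add:
  assumes "\<psi> \<in> periodic_test_functions" "\<eta> \<in> periodic_test_functions"
  shows "(\<lambda>x. \<psi> x + \<eta> x) \<in> periodic_test_functions"
  using periodic_test_functions_linear [OF assms, of 1 1] by simp

lemma periodic_test_functions_diff:
  assumes "\<psi> \<in> periodic_test_functions" "\<eta> \<in> periodic_test_functions"
  shows "(\<lambda>x. \<psi> x - \<eta> x) \<in> periodic_test_functions"
  using periodic_test_functions_linear [OF assms, of 1 "-1"] by simp

text \<open>Stating periodicity through \<open>cis\<close> lets \<psi> pass to the unit circle, and
  lets any argument be replaced by its representative in (-pi, pi].\<close>

lemma periodic_test_functions_periodic:
  assumes "\<psi> \<in> periodic_test_functions" and "cis x = cis y"
  shows "\<psi> x = \<psi> y"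
proof -
  have "\<psi> (x + 2 * pi) = \<psi> x" for x
    using assms(1) by (simp add: periodic_test_functions_def)
  then interpret periodic_fun_simple \<psi> "2 * pi"
    by unfold_locales
  obtain k :: int where "\<i> * complex_of_real x = \<i> * of_real y + (of_int (2 * k) * pi) * \<i>"
    using assms(2) unfolding cis_conv_exp exp_eq by blast
  then have "\<i> * complex_of_real x = \<i> * complex_of_real (y + of_int k * (2 * pi))"
    by (simp add: algebra_simps)
  then have "x = y + of_int k * (2 * pi)"
    by (metis complex_i_not_zero mult_left_cancel of_real_eq_iff)
  then show ?thesis
    by (simp only: plus_of_int)
qed

text \<open>Coefficients sit in the generators, so induction has just two cases, and zero and the
  constants come from \<open>n = 0\<close>.\<close>

inductive trig_poly :: "(real \<Rightarrow> complex) \<Rightarrow> bool" where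
  character: "trig_poly (\<lambda>x. c * character n x)"
| add: "trig_poly p \<Longrightarrow> trig_poly q \<Longrightarrow> trig_poly (\<lambda>x. p x + q x)"

lemma trig_poly_const: "trig_poly (\<lambda>x. c)"
  using trig_poly.character [of c 0] by simp

lemma trig_poly_test_function: "trig_poly p \<Longrightarrow> p \<in> periodic_test_functions"
  by (induction rule: trig_poly.induct)
     (auto intro: character_test_function periodic_test_functions_add)

lemma trig_poly_mult_character: "trig_poly p \<Longrightarrow> trig_poly (\<lambda>x. c * character n x * p x)"
proof (induction rule: trig_poly.induct)
  case (character d m)
  show ?case
    using trig_poly.character [of "c * d" "n + m"] by (simp add: character_add mult_ac)
next
  case (add p q)
  then show ?case
    using trig_poly.add by (fastforce simp: distrib_left)
qed

lemma trig_poly_mult: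
  assumes "trig_poly p" "trig_poly q"
  shows "trig_poly (\<lambda>x. p x * q x)"
  using assms(1)
proof (induction rule: trig_poly.induct)
  case (character c n)
  show ?case
    by (rule trig_poly_mult_character) fact
next
  case (add p q)
  then show ?case
    using trig_poly.add by (fastforce simp: distrib_right)
qed

text \<open>The number \<open>a\<close> is the mean of \<open>p\<close>: only the constant mode
  lacks a trigonometric antiderivative; every other coefficient is divided by i n.\<close>

lemma trig_poly_antiderivative:
  assumes "trig_poly p"
  shows "\<exists>a q. trig_poly q \<and> (\<forall>x. (q has_vector_derivative p x - a) (at x))"
  using assms
proof (induction rule: trig_poly.induct)
  case (character c n)
  show ?case
  proof (cases "n = 0")
    case True
    then show ?thesis
      by (intro exI [of _ c] exI [of _ "\<lambda>x. 0"]) (simp add: trig_poly_const)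
  next
    case False
    have "((\<lambda>x. c / (\<i> * of_int n) * character n x) has_vector_derivative
        c / (\<i> * of_int n) * (\<i> * of_int n * character n x)) (at x)" for x
      by (intro has_vector_derivative_mult_right character_has_vector_derivative)
    with False have "((\<lambda>x. c / (\<i> * of_int n) * character n x) has_vector_derivative
        c * character n x - 0) (at x)" for x
      by simp
    with trig_poly.character show ?thesis
      by blast
  qed
next
  case (add p q)
  then obtain a P b Q where
    P: "trig_poly P" "\<And>x. (P has_vector_derivative p x - a) (at x)" and
    Q: "trig_poly Q" "\<And>x. (Q has_vector_derivative q x - b) (at x)"
    by blast
  have "((\<lambda>x. P x + Q x) has_vector_derivative p x + q x - (a + b)) (at x)" for x
    using has_vector_derivative_add [OF P(2) Q(2)] by (simp add: algebra_simps)
  with trig_poly.add [OF P(1) Q(1)] show ?case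
    by blast
qed

text \<open>A real-linear map on the plane is fixed by its values at 1 and i, so on the circle it
  combines cos and sin, hence by Euler's formula the characters 1 and -1. Sums and products stay
  within \<open>trig_poly\<close>.\<close>

lemma real_polynomial_function_cis_trig_poly:
  fixes g :: "complex \<Rightarrow> real"
  assumes "real_polynomial_function g"
  shows "trig_poly (\<lambda>x. complex_of_real (g (cis x)))"
  using assms
proof (induction rule: real_polynomial_function.induct)
  case (linear f)
  then interpret bounded_linear f .
  have f: "f (cis x) = cos x * f 1 + sin x * f \<i>" for x
  proof -
    have "f (cis x) = f (cos x *\<^sub>R 1 + sin x *\<^sub>R \<i>)"
      by (rule arg_cong [of _ _ f]) (simp add: complex_eq_iff)
    then show ?thesis
      by (simp only: add scaleR real_scaleR_def)
  qed
  have "complex_of_real (f (cis x)) =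
      (complex_of_real (f 1) / 2 + complex_of_real (f \<i>) / (2 * \<i>)) * character 1 x +
      (complex_of_real (f 1) / 2 - complex_of_real (f \<i>) / (2 * \<i>)) * character (-1) x" for x
    unfolding f character_def of_real_add of_real_mult
    by (simp add: cos_of_real [symmetric] sin_of_real [symmetric] cos_exp_eq sin_exp_eq field_simps
             del: cos_of_real sin_of_real)
  then show ?case
    by (simp add: trig_poly.intros)
next
  case (const c)
  then show ?case by (rule trig_poly_const)
next
  case (add f g)
  then show ?case by (simp add: trig_poly.add)
next
  case (mult f g)
  then show ?case by (simp add: trig_poly_mult)
qed

text \<open>\<open>Arg\<close> jumps across the negative real axis. Near such points it is exchanged
  for \<open>Arg2pi\<close>, which is continuous there; the two angles differ by a multiple of 2 pi,
  which \<psi> does not see.\<close>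

lemma continuous_on_circle_Arg:
  assumes "\<psi> \<in> periodic_test_functions"
  shows "continuous_on (sphere 0 1) (\<lambda>z. \<psi> (Arg z))"
proof (intro continuous_at_imp_continuous_on ballI)
  have cont: "isCont \<psi> x" for x
    using test_function_has_vector_derivative [OF assms] by (rule has_vector_derivative_continuous)
  have eq: "\<psi> (Arg w) = \<psi> (Arg2pi w)" if "w \<noteq> 0" for w
  proof (rule periodic_test_functions_periodic [OF assms])
    have "of_real (cmod w) * cis (Arg2pi w) = w"
      using Arg2pi_eq [of w] by (simp add: cis_conv_exp mult.commute)
    moreover have "of_real (cmod w) * cis (Arg w) = w"
      using rcis_cmod_Arg [of w] by (simp add: rcis_def)
    ultimately show "cis (Arg w) = cis (Arg2pi w)"
      using that by (metis mult_left_cancel norm_eq_zero of_real_eq_0_iff)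
  qed
  fix z :: complex
  assume z: "z \<in> sphere 0 1"
  show "isCont (\<lambda>z. \<psi> (Arg z)) z"
  proof (cases "z \<in> \<real>\<^sub>\<le>\<^sub>0")
    case False
    then show ?thesis
      using isCont_o2 [OF continuous_at_Arg cont] by blast
  next
    case True
    from z have "z \<noteq> 0"
      by auto
    with True have "z \<notin> \<real>\<^sub>\<ge>\<^sub>0"
      by (simp add: complex_nonpos_Reals_iff complex_nonneg_Reals_iff complex_eq_iff)
    with \<open>z \<noteq> 0\<close> have "isCont (\<lambda>z. \<psi> (Arg2pi z)) z"
      using isCont_o2 [OF continuous_at_Arg2pi cont] by blast
    moreover have "\<forall>\<^sub>F w in nhds z. \<psi> (Arg w) = \<psi> (Arg2pi w)"
      using t1_space_nhds [OF \<open>z \<noteq> 0\<close>] by eventually_elim (rule eq)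
    ultimately show ?thesis
      using isCont_cong by force
  qed
qed

text \<open>Stone-Weierstrass is applied on the circle to \<psi> composed with \<open>Arg\<close>,
  and the resulting polynomial is pulled back along \<open>cis\<close>.\<close>

lemma trig_poly_uniform_approx:
  assumes "\<psi> \<in> periodic_test_functions" "0 < \<epsilon>"
  shows "\<exists>p. trig_poly p \<and> (\<forall>x. cmod (\<psi> x - p x) < \<epsilon>)"
proof -
  obtain g where g: "polynomial_function g" "\<And>z. z \<in> sphere 0 1 \<Longrightarrow> cmod (\<psi> (Arg z) - g z) < \<epsilon>"
    using Stone_Weierstrass_polynomial_function [OF compact_sphere continuous_on_circle_Arg [OF assms(1)] assms(2)]
    by blast
  have "real_polynomial_function (Re \<circ> g)" "real_polynomial_function (Im \<circ> g)"
    using g(1) bounded_linear_Re bounded_linear_Im unfolding polynomial_function_def by blast+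
  then have "trig_poly (\<lambda>x. of_real ((Re \<circ> g) (cis x)) + \<i> * of_real ((Im \<circ> g) (cis x)))"
    by (intro trig_poly.add trig_poly_mult trig_poly_const real_polynomial_function_cis_trig_poly)
  then have "trig_poly (\<lambda>x. g (cis x))"
    by (simp add: complex_eq [symmetric])
  moreover have "cmod (\<psi> x - g (cis x)) < \<epsilon>" for x
  proof -
    have "\<psi> (Arg (cis x)) = \<psi> x"
      by (rule periodic_test_functions_periodic [OF assms(1)]) (simp add: cis_Arg sgn_eq)
    then show ?thesis
      using g(2) [of "cis x"] by simp
  qed
  ultimately show ?thesis
    by blast
qed

section \<open>Approximation with control of derivatives\<close>

lemma vector_differentiable_bound:
  fixes f :: "real \<Rightarrow> 'a::real_normed_vector"
  assumes "\<And>x. (f has_vector_derivative f' x) (at x)" and "\<And>x. norm (f' x) \<le> B"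
  shows "norm (f x - f y) \<le> B * \<bar>x - y\<bar>"
proof -
  have "onorm (\<lambda>h. h *\<^sub>R f' x) \<le> B" for x
  proof (rule onorm_le)
    fix h :: real
    show "norm (h *\<^sub>R f' x) \<le> B * norm h"
      using mult_right_mono [OF assms(2) [of x] abs_ge_zero [of h]] by (simp add: mult.commute)
  qed
  then have "norm (f x - f y) \<le> B * norm (x - y)"
    using assms(1) by (intro differentiable_bound [of UNIV]) (auto simp: has_vector_derivative_def)
  then show ?thesis
    by simp
qed

text \<open>By periodicity x may be moved to within pi of 0, where the mean value inequality gives a
  bound uniform in x.\<close>

lemma periodic_test_function_diff_le:
  assumes "\<psi> \<in> periodic_test_functions" and "\<And>x. cmod (vderiv \<psi> x) \<le> B"
  shows "cmod (\<psi> x - \<psi> 0) \<le> 2 * pi * B"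
proof -
  have "\<psi> x = \<psi> (Arg (cis x))"
    by (rule periodic_test_functions_periodic [OF assms(1)]) (simp add: cis_Arg sgn_eq)
  then have "cmod (\<psi> x - \<psi> 0) \<le> B * \<bar>Arg (cis x) - 0\<bar>"
    using vector_differentiable_bound [OF test_function_has_vector_derivative [OF assms(1)] assms(2)]
    by metis
  also have "\<dots> \<le> B * (2 * pi)"
    using Arg_bounded [of "cis x"] order_trans [OF norm_ge_zero assms(2)]
    by (intro mult_left_mono) auto
  finally show ?thesis
    by (simp add: mult_ac)
qed

text \<open>Over one period \<open>\<psi> x - x a\<close> changes by exactly -2 pi a, while its
  derivative is at most \<open>B\<close> in modulus.\<close>

lemma periodic_test_function_mean_le:
  assumes "\<psi> \<in> periodic_test_functions" and "\<And>x. cmod (vderiv \<psi> x - a) \<le> B"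
  shows "cmod a \<le> B"
proof -
  have "((\<lambda>x. \<psi> x - x *\<^sub>R a) has_vector_derivative vderiv \<psi> x - a) (at x)" for x
    using test_function_has_vector_derivative [OF assms(1)]
    by (auto intro!: derivative_eq_intros)
  from vector_differentiable_bound [OF this assms(2), of "2 * pi" 0]
  have "cmod (\<psi> (2 * pi) - \<psi> 0 - (2 * pi) *\<^sub>R a) \<le> B * (2 * pi)"
    by (simp add: algebra_simps)
  moreover have "\<psi> (2 * pi) = \<psi> 0"
    by (rule periodic_test_functions_periodic [OF assms(1)]) simp
  ultimately have "2 * pi * cmod a \<le> 2 * pi * B"
    by (simp add: norm_mult mult_ac)
  then show ?thesis
    by simp
qed

text \<open>The constant cancels in the difference quotient, so both sides are the same choice of
  derivative, even at points of non-differentiability.\<close>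

lemma vderiv_add_const: "vderiv (\<lambda>x. f x + c) = vderiv f"
  unfolding vderiv_def vector_derivative_def has_vector_derivative_def has_derivative_def
  by simp

text \<open>Induction on the number of derivatives: approximate \<open>\<psi>'\<close> by \<open>p\<close>, and integrate \<open>p\<close> after
  removing its mean \<open>a\<close>, which is small because \<open>\<psi>'\<close> has mean zero.\<close>

lemma trig_poly_approx:
  assumes "\<psi> \<in> periodic_test_functions" "0 < \<epsilon>"
  shows "\<exists>p. trig_poly p \<and> (\<forall>k\<le>m. \<forall>x. cmod ((vderiv ^^ k) (\<lambda>x. \<psi> x - p x) x) < \<epsilon>)"
  using assms
proof (induction m arbitrary: \<psi> \<epsilon>)
  case 0
  then show ?case
    using trig_poly_uniform_approx by simp
next
  case (Suc m)
  \<comment> \<open>The divisor covers all losses: 4 pi \<delta> for values, 2 \<delta> for the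
    first derivative, \<delta> for higher ones.\<close>
  define \<delta> where "\<delta> = \<epsilon> / (4 * pi + 4)"
  have \<delta>: "0 < \<delta>" "(4 * pi + 4) * \<delta> = \<epsilon>"
  proof -
    have "0 < 4 * pi + 4"
      using pi_gt_zero by linarith
    with Suc.prems(2) show "0 < \<delta>" "(4 * pi + 4) * \<delta> = \<epsilon>"
      by (auto simp: \<delta>_def)
  qed
  obtain p where p: "trig_poly p"
    "\<forall>k\<le>m. \<forall>x. cmod ((vderiv ^^ k) (\<lambda>x. vderiv \<psi> x - p x) x) < \<delta>"
    using Suc.IH [OF vderiv_test_function [OF Suc.prems(1)] \<delta>(1)] by (elim exE conjE)
  obtain a q where q: "trig_poly q" "\<And>x. (q has_vector_derivative p x - a) (at x)"
    using trig_poly_antiderivative [OF p(1)] by blast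
  define h where "h = (\<lambda>x. \<psi> x - q x)"
  have h: "h \<in> periodic_test_functions"
    unfolding h_def using Suc.prems(1) trig_poly_test_function [OF q(1)]
    by (rule periodic_test_functions_diff)
  have h': "vderiv h = (\<lambda>x. (vderiv \<psi> x - p x) + a)"
    unfolding h_def
    using has_vector_derivative_diff [OF test_function_has_vector_derivative [OF Suc.prems(1)] q(2)]
    by (intro vderiv_eqI) (simp add: algebra_simps)
  have close: "cmod (vderiv \<psi> x - p x) \<le> \<delta>" for x
    using p(2) [rule_format, of 0 x] by simp
  have a: "cmod a \<le> \<delta>"
    by (rule periodic_test_function_mean_le [OF h]) (simp add: h' close)
  have h'_le: "cmod (vderiv h x) \<le> 2 * \<delta>" for x
    unfolding h' using norm_triangle_mono [OF close a] by simp
  \<comment> \<open>Adding \<open>h 0\<close> to \<open>q\<close> makes the error vanish at 0, so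
    its values are controlled by its derivative.\<close>
  have "cmod ((vderiv ^^ k) (\<lambda>x. \<psi> x - (q x + h 0)) x) < \<epsilon>" if "k \<le> Suc m" for k x
  proof (cases k)
    case 0
    have "cmod (h x - h 0) \<le> 2 * pi * (2 * \<delta>)"
      by (rule periodic_test_function_diff_le [OF h h'_le])
    also have "\<dots> < (4 * pi + 4) * \<delta>"
      using \<delta>(1) by (simp add: algebra_simps)
    finally show ?thesis
      using 0 \<delta>(2) by (simp add: h_def algebra_simps)
  next
    case (Suc j)
    have "(\<lambda>x. \<psi> x - (q x + h 0)) = (\<lambda>x. h x + - h 0)"
      by (simp add: h_def algebra_simps)
    then have eq: "(vderiv ^^ k) (\<lambda>x. \<psi> x - (q x + h 0)) x =
        (vderiv ^^ j) (\<lambda>x. (vderiv \<psi> x - p x) + a) x"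
      unfolding Suc funpow_Suc_right o_def by (simp only: vderiv_add_const h')
    have "\<delta> \<le> (4 * pi + 4) * \<delta> / 4"
      using \<delta>(1) pi_gt_zero by (simp add: algebra_simps)
    with \<delta> have small: "2 * \<delta> < \<epsilon>"
      by linarith
    show ?thesis
    proof (cases j)
      case 0
      then show ?thesis
        unfolding eq using h'_le [of x] small by (simp add: h')
    next
      \<comment> \<open>From the second derivative on the constant \<open>a\<close> disappears, and
        the bound on \<open>p\<close> applies directly.\<close>
      case j: (Suc i)
      then have "(vderiv ^^ j) (\<lambda>x. (vderiv \<psi> x - p x) + a) = (vderiv ^^ j) (\<lambda>x. vderiv \<psi> x - p x)"
        unfolding j funpow_Suc_right o_def by (simp only: vderiv_add_const)
      then show ?thesis
        unfolding eq using p(2) [rule_format, of j x] that Suc small \<delta>(1) by simp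
    qed
  qed
  moreover have "trig_poly (\<lambda>x. q x + h 0)"
    by (intro trig_poly.add q(1) trig_poly_const)
  ultimately show ?case
    by (intro exI [of _ "\<lambda>x. q x + h 0"] conjI allI impI)
qed

subsection \<open>Uniqueness of Fourier coefficients\<close>

lemma pairing_linear:
  assumes "\<psi> \<in> periodic_test_functions" "\<eta> \<in> periodic_test_functions"
  shows "pairing f (\<lambda>x. a * \<psi> x + b * \<eta> x) = a * pairing f \<psi> + b * pairing f \<eta>"
  using pairing [of f] assms unfolding is_periodic_distribution_def by blast

lemma pairing_outside: "\<psi> \<notin> periodic_test_functions \<Longrightarrow> pairing f \<psi> = 0"
  using pairing [of f] unfolding is_periodic_distribution_def by blast

lemma fourier_eq_pairing_character: "fourier f n = pairing f (character (- n)) / (2 * of_real pi)"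
  by (simp add: fourier_def character_def [abs_def])

lemma pairing_trig_poly_eq_0:
  assumes "trig_poly p" and "\<And>n. fourier f n = 0"
  shows "pairing f p = 0"
  using assms(1)
proof (induction rule: trig_poly.induct)
  case (character c n)
  have "character n \<in> periodic_test_functions"
    using character_test_function [of 1 n] by simp
  with assms(2) [of "- n"] show ?case
    using pairing_linear [of "character n" "character n" f c 0]
    by (simp add: fourier_eq_pairing_character)
next
  case (add p q)
  then show ?case
    using pairing_linear [OF add.hyps [THEN trig_poly_test_function], of f 1 1] by simp
qed

text \<open>Continuity of \<open>f\<close> involves only finitely many seminorms. Approximating
  \<psi> in these by a trigonometric polynomial, on which \<open>f\<close> vanishes, makes
  \<open>pairing f \<psi>\<close> arbitrarily small.\<close>

lemma fourier_eq_0_imp_eq_0: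
  assumes "\<And>n. fourier f n = 0"
  shows "f = 0"
proof -
  obtain C m where C: "\<And>\<psi>. \<psi> \<in> periodic_test_functions \<Longrightarrow>
      cmod (pairing f \<psi>) \<le> C * (\<Sum>k\<le>m. test_seminorm k \<psi>)"
    using pairing [of f] unfolding is_periodic_distribution_def by blast
  have "pairing f \<psi> = 0" if \<psi>: "\<psi> \<in> periodic_test_functions" for \<psi>
  proof -
    have "cmod (pairing f \<psi>) \<le> 0 + \<epsilon>" if "0 < \<epsilon>" for \<epsilon>
    proof -
      \<comment> \<open>There are \<open>Suc m\<close> seminorms, each at most \<delta>;
        \<open>\<bar>C\<bar> + 1\<close> keeps the divisor positive whatever the sign of
        \<open>C\<close>.\<close>
      define \<delta> where "\<delta> = \<epsilon> / ((\<bar>C\<bar> + 1) * Suc m)"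
      have \<delta>: "0 < \<delta>" "(\<bar>C\<bar> + 1) * Suc m * \<delta> = \<epsilon>"
      proof -
        have "0 < (\<bar>C\<bar> + 1) * real (Suc m)"
          by (intro mult_pos_pos) auto
        with that show "0 < \<delta>" "(\<bar>C\<bar> + 1) * Suc m * \<delta> = \<epsilon>"
          unfolding \<delta>_def by (simp_all only: divide_pos_pos nonzero_mult_div_cancel_left times_divide_eq_right less_irrefl)
      qed
      obtain p where p: "trig_poly p"
        "\<forall>k\<le>m. \<forall>x. cmod ((vderiv ^^ k) (\<lambda>x. \<psi> x - p x) x) < \<delta>"
        using trig_poly_approx [OF \<psi> \<delta>(1), of m] by (elim exE conjE)
      note p_test = trig_poly_test_function [OF p(1)]
      note d_test = periodic_test_functions_diff [OF \<psi> p_test]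
      have "test_seminorm k (\<lambda>x. \<psi> x - p x) \<le> \<delta>" if "k \<le> m" for k
        unfolding test_seminorm_def using p(2) that
        by (intro cSUP_least) (auto intro: less_imp_le)
      then have "(\<Sum>k\<le>m. test_seminorm k (\<lambda>x. \<psi> x - p x)) \<le> Suc m * \<delta>"
        using sum_bounded_above [of "{..m}" "\<lambda>k. test_seminorm k (\<lambda>x. \<psi> x - p x)" \<delta>] by simp
      moreover have "0 \<le> (\<Sum>k\<le>m. test_seminorm k (\<lambda>x. \<psi> x - p x))"
        by (intro sum_nonneg test_seminorm_nonneg d_test)
      ultimately have "C * (\<Sum>k\<le>m. test_seminorm k (\<lambda>x. \<psi> x - p x)) \<le> (\<bar>C\<bar> + 1) * (Suc m * \<delta>)"
        by (intro mult_mono) auto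
      moreover have "pairing f \<psi> = pairing f (\<lambda>x. \<psi> x - p x)"
        using pairing_linear [OF \<psi> p_test, of f 1 "-1"] pairing_trig_poly_eq_0 [OF p(1) assms]
        by simp
      ultimately show ?thesis
        using C [OF d_test] \<delta>(2) by (simp add: mult.assoc)
    qed
    then show ?thesis
      using field_le_epsilon [of "cmod (pairing f \<psi>)" 0] by simp
  qed
  then have "pairing f = pairing 0"
    using pairing_outside [of _ f] by (auto simp: fun_eq_iff zero_periodic_distribution.rep_eq)
  then show ?thesis
    by (simp add: pairing_inject)
qed

lemma fourier_inject:
  assumes "\<And>n. fourier f n = fourier g n"
  shows "f = g"
proof -
  have "fourier (f - g) n = 0" for n
    using assms [of n] by (simp add: fourier_def minus_periodic_distribution.rep_eq)
  then show ?thesis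
    using fourier_eq_0_imp_eq_0 [of "f - g"] by simp
qed

text \<open>Resolves the definite description: \<open>fourier_inject\<close> supplies uniqueness, so
  exhibiting one candidate suffices.\<close>

lemma fourier_multiplier_eqI:
  assumes "\<And>n. fourier g n = m n * fourier f n"
  shows "fourier_multiplier m f = g"
  unfolding fourier_multiplier_def
proof (rule the_equality)
  show "\<forall>n. fourier g n = m n * fourier f n"
    using assms by blast
  show "h = g" if "\<forall>n. fourier h n = m n * fourier f n" for h
    using that assms by (intro fourier_inject) simp
qed

text \<open>The minus sign of the distributional derivative cancels the one from differentiating
  exp(-inx).\<close>

lemma fourier_distr_deriv: "fourier (distr_deriv f) n = \<i> * of_int n * fourier f n"
proof -
  have test: "character (- n) \<in> periodic_test_functions"
    using character_test_function [of 1 "- n"] by simp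
  have "vderiv (character (- n)) = (\<lambda>x. - \<i> * of_int n * character (- n) x)"
    by (intro vderiv_eqI) (use character_has_vector_derivative [of "- n"] in simp)
  then have "pairing f (vderiv (character (- n))) = - \<i> * of_int n * pairing f (character (- n))"
    using pairing_linear [OF test test, of f "- \<i> * of_int n" 0] by simp
  with test show ?thesis
    by (simp add: fourier_eq_pairing_character distr_deriv.rep_eq)
qed

subsection \<open>Single-mode solutions\<close>

text \<open>The function c exp(inx) as a distribution, acting by integration over a period; it has
  order zero, since the sup norm of \<psi> alone bounds the pairing.\<close>

lift_definition mode :: "int \<Rightarrow> complex \<Rightarrow> periodic_distribution"
  is "\<lambda>n c \<psi>. if \<psi> \<in> periodic_test_functions
        then c * integral {-pi..pi} (\<lambda>x. character n x * \<psi> x) else 0"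
proof -
  fix n c
  have cont: "continuous_on A \<psi>" if "\<psi> \<in> periodic_test_functions" for \<psi> and A
    using has_vector_derivative_continuous [OF test_function_has_vector_derivative [OF that]]
    by (simp add: continuous_at_imp_continuous_on)
  have int: "(\<lambda>x. character n x * \<psi> x) integrable_on {-pi..pi}"
    if "\<psi> \<in> periodic_test_functions" for \<psi>
    unfolding character_def
    by (intro integrable_continuous_interval continuous_intros cont that)
  have "cmod (c * integral {-pi..pi} (\<lambda>x. character n x * \<psi> x))
      \<le> (cmod c * (2 * pi)) * (\<Sum>k\<le>0. test_seminorm k \<psi>)"
    if \<psi>: "\<psi> \<in> periodic_test_functions" for \<psi>
  proof -
    have "compact ((\<lambda>x. cmod (\<psi> x)) ` {-pi..pi})"
      by (intro compact_continuous_image continuous_intros cont \<psi>) auto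
    then have bdd: "bdd_above ((\<lambda>x. cmod (\<psi> x)) ` {-pi..pi})"
      by (intro bounded_imp_bdd_above compact_imp_bounded)
    have "cmod (\<psi> x) \<le> test_seminorm 0 \<psi>" if "x \<in> {-pi..pi}" for x
      using cSUP_upper [OF that bdd] by (simp add: test_seminorm_def)
    then have "cmod (integral {-pi..pi} (\<lambda>x. character n x * \<psi> x))
        \<le> test_seminorm 0 \<psi> * Henstock_Kurzweil_Integration.content (cbox (-pi) pi)"
      using integrable_integral [OF int [OF \<psi>]] test_seminorm_nonneg [OF \<psi>]
      by (intro has_integral_bound [where f = "\<lambda>x. character n x * \<psi> x"])
         (auto simp: norm_mult character_def)
    then have "cmod (integral {-pi..pi} (\<lambda>x. character n x * \<psi> x)) \<le> 2 * pi * test_seminorm 0 \<psi>"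
      by (simp add: mult_ac)
    from mult_left_mono [OF this norm_ge_zero [of c]] show ?thesis
      by (simp add: norm_mult mult.assoc)
  qed
  then have "\<exists>C m. \<forall>\<psi>\<in>periodic_test_functions.
      cmod (c * integral {-pi..pi} (\<lambda>x. character n x * \<psi> x))
      \<le> C * (\<Sum>k\<le>m. test_seminorm k \<psi>)"
    by blast
  moreover have "c * integral {-pi..pi} (\<lambda>x. character n x * (a * \<psi> x + b * \<eta> x)) =
      a * (c * integral {-pi..pi} (\<lambda>x. character n x * \<psi> x)) +
      b * (c * integral {-pi..pi} (\<lambda>x. character n x * \<eta> x))"
    if "\<psi> \<in> periodic_test_functions" "\<eta> \<in> periodic_test_functions" for \<psi> \<eta> a b
  proof -
    have "((\<lambda>x. a * (character n x * \<psi> x) + b * (character n x * \<eta> x)) has_integral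
        a * integral {-pi..pi} (\<lambda>x. character n x * \<psi> x) +
        b * integral {-pi..pi} (\<lambda>x. character n x * \<eta> x)) {-pi..pi}"
      by (intro has_integral_add has_integral_mult_right integrable_integral int that)
    then show ?thesis
      by (simp add: integral_unique algebra_simps)
  qed
  ultimately show "is_periodic_distribution (\<lambda>\<psi>. if \<psi> \<in> periodic_test_functions
        then c * integral {-pi..pi} (\<lambda>x. character n x * \<psi> x) else 0)"
    unfolding is_periodic_distribution_def
    by (simp add: periodic_test_functions_linear)
qed

lemma pairing_mode: "pairing (mode n c) \<psi> = c * pairing (mode n 1) \<psi>"
  by (simp add: mode.rep_eq)

lemma integral_character:
  "integral {-pi..pi} (character n) = (if n = 0 then 2 * of_real pi else 0)"
proof (cases "n = 0")
  case True
  then have "character n = (\<lambda>x. 1)"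
    by auto
  with True show ?thesis
    by (simp add: scaleR_conv_of_real)
next
  case False
  have "((\<lambda>x. inverse (\<i> * of_int n) * character n x) has_vector_derivative
      inverse (\<i> * of_int n) * (\<i> * of_int n * character n x)) (at x within {-pi..pi})" for x
    by (rule has_vector_derivative_at_within)
       (intro has_vector_derivative_mult_right character_has_vector_derivative)
  with False have "((\<lambda>x. inverse (\<i> * of_int n) * character n x) has_vector_derivative
      character n x) (at x within {-pi..pi})" for x
    by (simp add: field_simps)
  then have "(character n has_integral
      inverse (\<i> * of_int n) * character n pi - inverse (\<i> * of_int n) * character n (- pi)) {-pi..pi}"
    by (intro fundamental_theorem_of_calculus) auto
  \<comment> \<open>Periodicity makes the two endpoint values of the antiderivative cancel.\<close>
  moreover have "character n (- pi + 2 * pi) = character n (- pi)"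
    using character_test_function [of 1 n] unfolding periodic_test_functions_def mem_Collect_eq
    by (metis mult_1)
  ultimately show ?thesis
    using False by (simp add: integral_unique)
qed

lemma fourier_mode: "fourier (mode n c) k = (if k = n then c else 0)"
proof -
  have "(\<lambda>x. character n x * character (- k) x) = character (n - k)"
    using character_add [of n "- k"] by (simp add: fun_eq_iff)
  moreover have "character (- k) \<in> periodic_test_functions"
    using character_test_function [of 1 "- k"] by simp
  ultimately show ?thesis
    by (simp add: fourier_eq_pairing_character mode.rep_eq integral_character)
qed

lemma fourier_multiplier_mode: "fourier_multiplier m (mode n c) = mode n (m n * c)"
  by (rule fourier_multiplier_eqI) (simp add: fourier_mode)

lemma
  shows mode_in_Hs: "mode n c \<in> Hs s"
    and Hs_norm_mode: "Hs_norm s (mode n c) = sqrt (2 * pi) * (1 + (real_of_int n)\<^sup>2) powr (s / 2) * cmod c"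
proof -
  have sum: "((\<lambda>k::int. (1 + \<bar>real_of_int k\<bar>\<^sup>2) powr s * (cmod (fourier (mode n c) k))\<^sup>2) has_sum
      ((1 + \<bar>real_of_int n\<bar>\<^sup>2) powr s * (cmod c)\<^sup>2)) UNIV"
    by (rule has_sum_finite_neutralI [of "{n}"]) (auto simp: fourier_mode)
  then show "mode n c \<in> Hs s"
    unfolding Hs_def mem_Collect_eq by (rule has_sum_imp_summable)
  have "Hs_norm s (mode n c) = sqrt (2 * pi * ((1 + (real_of_int n)\<^sup>2) powr s * (cmod c)\<^sup>2))"
    unfolding Hs_norm_def using infsumI [OF sum] by simp
  also have "(1 + (real_of_int n)\<^sup>2) powr s = ((1 + (real_of_int n)\<^sup>2) powr (s / 2))\<^sup>2"
    by (simp add: power2_eq_square powr_add [symmetric])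
  finally show "Hs_norm s (mode n c) = sqrt (2 * pi) * (1 + (real_of_int n)\<^sup>2) powr (s / 2) * cmod c"
    by (simp add: real_sqrt_mult)
qed

text \<open>The convolution has at most one nonzero term, at j = n, which contributes only to the
  frequency k = 2 n; all sums are therefore finite.\<close>

lemma is_product_mode: "is_product (distr_deriv (mode n c)) (mode n c) (mode (2 * n) (\<i> * of_int n * c\<^sup>2))"
  unfolding is_product_def
proof
  fix k
  show "((\<lambda>j. fourier (distr_deriv (mode n c)) j * fourier (mode n c) (k - j)) has_sum
      fourier (mode (2 * n) (\<i> * of_int n * c\<^sup>2)) k) UNIV"
    by (rule has_sum_finite_neutralI [of "{n}"])
       (auto simp: fourier_distr_deriv fourier_mode power2_eq_square)
qed

section \<open>Exact Duhamel integral of a single mode\<close>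

definition phase :: "int \<Rightarrow> real" where
  "phase n = of_int n / of_int (1 + \<bar>n\<bar>)"

lemma S_mode: "S t (mode n c) = mode n (exp (- (\<i> * of_real (phase n * t))) * c)"
proof -
  have "\<i> * of_int n / of_int (1 + \<bar>n\<bar>) * of_real t = \<i> * of_real (phase n * t)"
    by (simp add: phase_def flip: of_int_abs)
  then show ?thesis
    unfolding S_def fourier_multiplier_mode by simp
qed

lemma \<Lambda>_mode: "\<Lambda> (mode n c) = mode n (c / of_int (1 + \<bar>n\<bar>))"
  unfolding \<Lambda>_def fourier_multiplier_mode by (simp add: divide_inverse mult.commute)

text \<open>Frequency mismatch between the square of the free wave at \<open>n\<close> and the free wave at \<open>2n\<close>.\<close>

definition resonance :: "int \<Rightarrow> real" where
  "resonance n = 2 * phase n - phase (2 * n)"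

text \<open>The factors are the free evolution at 2n, the weight of \<Lambda> times the n from the
  derivative, and i times the integral of exp(-i r \<tau>) over [0,t], where r is the
  resonance.\<close>

definition duhamel_coeff :: "int \<Rightarrow> real \<Rightarrow> complex" where
  "duhamel_coeff n t = exp (- (\<i> * of_real (phase (2 * n) * t))) *
     (of_int n / of_int (1 + \<bar>2 * n\<bar>)) *
     ((1 - exp (- (\<i> * of_real (resonance n * t)))) / of_real (resonance n))"

text \<open>Pairing a mode with a fixed \<psi> is linear in the amplitude, so each test reduces to
  the scalar fundamental theorem of calculus, in either orientation of the interval.\<close>

lemma is_integral_mode:
  assumes "\<And>\<tau>. (c has_vector_derivative c' \<tau>) (at \<tau>)" and "continuous_on UNIV c'"
  shows "is_integral a b (\<lambda>\<tau>. mode n (c' \<tau>)) (mode n (c b - c a))"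
  unfolding is_integral_def
proof (intro ballI conjI)
  fix \<psi>
  define I where "I = pairing (mode n 1) \<psi>"
  have eq: "pairing (mode n z) \<psi> = z * I" for z
    unfolding I_def by (rule pairing_mode)
  have cont: "continuous_on A (\<lambda>\<tau>. c' \<tau> * I)" for A
    by (intro continuous_intros continuous_on_subset [OF assms(2)]) auto
  show "interval_lebesgue_integrable lborel (ereal a) (ereal b) (\<lambda>\<tau>. pairing (mode n (c' \<tau>)) \<psi>)"
    unfolding eq using cont [of UNIV]
    by (intro interval_integrable_isCont) (simp add: continuous_on_eq_continuous_at)
  have "(LBINT \<tau>=ereal a..ereal b. c' \<tau> * I) = c b * I - c a * I"
  proof (rule interval_integral_FTC_finite [OF cont])
    show "((\<lambda>\<tau>. c \<tau> * I) has_vector_derivative c' \<tau> * I) (at \<tau> within {min a b..max a b})" for \<tau>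
      using has_vector_derivative_mult_left [OF assms(1)] by (rule has_vector_derivative_at_within)
  qed
  then show "(LBINT \<tau>=ereal a..ereal b. pairing (mode n (c' \<tau>)) \<psi>) = pairing (mode n (c b - c a)) \<psi>"
    unfolding eq by (simp add: algebra_simps)
qed

text \<open>Propagating the squared wave from \<tau> to t gives the phase p(2n)(t - \<tau>) + 2 p(n)
  \<tau>, that is p(2n) t plus the resonance times \<tau>. A nonzero resonance permits explicit
  integration.\<close>

lemma is_duhamel_mode:
  assumes "resonance n \<noteq> 0"
  shows "is_duhamel T (restrict_time T (\<lambda>t. S t (mode n 1)))
    (restrict_time T (\<lambda>t. mode (2 * n) (duhamel_coeff n t)))"
proof -
  define w where "w \<tau> = mode (2 * n) (\<i> * of_int n * (exp (- (\<i> * of_real (phase n * \<tau>))))\<^sup>2)" for \<tau>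
  have "is_product (distr_deriv (restrict_time T (\<lambda>t. S t (mode n 1)) \<tau>))
      (restrict_time T (\<lambda>t. S t (mode n 1)) \<tau>) (w \<tau>)" if "\<tau> \<in> {-T..T}" for \<tau>
    using that is_product_mode by (simp add: restrict_time_def S_mode w_def)
  moreover have "is_integral 0 t (\<lambda>\<tau>. S (t - \<tau>) (\<Lambda> (w \<tau>)))
      (restrict_time T (\<lambda>t. mode (2 * n) (duhamel_coeff n t)) t)" if "t \<in> {-T..T}" for t
  proof -
    \<comment> \<open>\<open>A\<close> gathers the factors independent of \<tau>; dividing
      \<open>c'\<close> by -i times the resonance gives the antiderivative \<open>c\<close>.\<close>
    define A where "A = exp (- (\<i> * of_real (phase (2 * n) * t))) * (of_int n / of_int (1 + \<bar>2 * n\<bar>))"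
    define c where "c \<tau> = - A / of_real (resonance n) * exp (- (\<i> * of_real (resonance n * \<tau>)))" for \<tau>
    define c' where "c' \<tau> = \<i> * A * exp (- (\<i> * of_real (resonance n * \<tau>)))" for \<tau>
    have "(c has_vector_derivative c' \<tau>) (at \<tau>)" for \<tau>
      unfolding c_def [abs_def] c'_def using assms
      by (auto intro!: derivative_eq_intros has_vector_derivative_real_field simp: field_simps)
    moreover have "continuous_on UNIV c'"
      unfolding c'_def [abs_def] by (intro continuous_intros)
    ultimately have "is_integral 0 t (\<lambda>\<tau>. mode (2 * n) (c' \<tau>)) (mode (2 * n) (c t - c 0))"
      by (rule is_integral_mode)
    moreover have "S (t - \<tau>) (\<Lambda> (w \<tau>)) = mode (2 * n) (c' \<tau>)" for \<tau>
    proof -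
      have "exp (- (\<i> * of_real (phase (2 * n) * (t - \<tau>)))) * (exp (- (\<i> * of_real (phase n * \<tau>))))\<^sup>2
          = exp (- (\<i> * of_real (phase (2 * n) * t))) * exp (- (\<i> * of_real (resonance n * \<tau>)))"
        unfolding resonance_def exp_double [symmetric] exp_add [symmetric]
        by (rule arg_cong [of _ _ exp]) (simp add: algebra_simps)
      then show ?thesis
        unfolding w_def \<Lambda>_mode S_mode c'_def A_def by (simp add: mult_ac)
    qed
    moreover have "c t - c 0 = duhamel_coeff n t"
      unfolding c_def duhamel_coeff_def A_def [symmetric] using assms by (simp add: field_simps)
    ultimately show ?thesis
      using that by (simp add: restrict_time_def)
  qed
  moreover have "vanishes_outside T (restrict_time T (\<lambda>t. mode (2 * n) (duhamel_coeff n t)))"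
    by (simp add: vanishes_outside_def restrict_time_def)
  ultimately show ?thesis
    unfolding is_duhamel_def by blast
qed

text \<open>With x = n the resonance is 2 x^2 / ((1 + x)(1 + 2x)), whose denominator lies between 2
  x^2 and 6 x^2 for x >= 1.\<close>

lemma resonance_bounds:
  assumes "0 < n"
  shows "1/3 \<le> resonance n" and "resonance n \<le> 1"
proof -
  define x where "x = real_of_int n"
  have x: "1 \<le> x"
    using assms by (simp add: x_def)
  have eq: "resonance n = 2 * x / (1 + x) - 2 * x / (1 + 2 * x)"
    using assms by (simp add: resonance_def phase_def x_def)
  have "resonance n = 2 * x\<^sup>2 / ((1 + x) * (1 + 2 * x))"
    unfolding eq using x by (simp add: field_simps power2_eq_square)
  moreover have "(1 + x) * (1 + 2 * x) \<le> 6 * x\<^sup>2"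
  proof -
    have "x \<le> x\<^sup>2" "1 \<le> x\<^sup>2"
      using x by (simp_all add: self_le_power)
    then show ?thesis
      by (simp add: algebra_simps power2_eq_square)
  qed
  moreover have "2 * x\<^sup>2 \<le> (1 + x) * (1 + 2 * x)"
    using x by (simp add: algebra_simps power2_eq_square)
  moreover have "0 < (1 + x) * (1 + 2 * x)"
    using x by simp
  ultimately show "1/3 \<le> resonance n" and "resonance n \<le> 1"
    by (simp_all add: pos_le_divide_eq)
qed

text \<open>The modulus of 1 - exp(-i a) is 2 |sin(a/2)|. Here a/2 lies between t/6 and 1/2, where
  sine increases; moreover 1/\<theta> >= 1 and n/(1 + 2n) >= 1/3. The bound is uniform in
  \<open>n\<close>.\<close>

lemma cmod_duhamel_coeff_ge:
  assumes "0 < n" "0 < t" "t \<le> 1"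
  shows "2/3 * sin (t / 6) \<le> cmod (duhamel_coeff n t)"
proof -
  define \<theta> where "\<theta> = resonance n"
  note \<theta> = resonance_bounds [OF assms(1), folded \<theta>_def]
  have "cmod (1 - exp (- (\<i> * of_real (\<theta> * t)))) = 2 * \<bar>sin (\<theta> * t / 2)\<bar>"
    using dist_exp_i_1 [of "- (\<theta> * t)"] by (simp add: norm_minus_commute)
  moreover have "sin (t / 6) \<le> sin (\<theta> * t / 2)"
  proof (rule sin_monotone_2pi_le)
    show "t / 6 \<le> \<theta> * t / 2"
      using mult_right_mono [OF \<theta>(1), of t] assms by simp
    have "\<theta> * t \<le> 1 * 1"
      using \<theta> assms by (intro mult_mono) auto
    then show "\<theta> * t / 2 \<le> pi / 2"
      using pi_gt3 by linarith
    show "- (pi / 2) \<le> t / 6"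
      using assms pi_gt_zero by linarith
  qed
  ultimately have 1: "2 * sin (t / 6) \<le> cmod (1 - exp (- (\<i> * of_real (\<theta> * t))))"
    by linarith
  have "0 \<le> sin (t / 6)"
    using assms pi_gt3 by (intro sin_ge_zero) auto
  then have "2 * sin (t / 6) * 1 \<le> cmod (1 - exp (- (\<i> * of_real (\<theta> * t)))) * (1 / \<theta>)"
    using 1 \<theta> by (intro mult_mono [of "2 * sin (t / 6)"]) auto
  moreover have "(1/3::real) \<le> of_int n / of_int (1 + \<bar>2 * n\<bar>)"
    using assms(1) by (simp add: field_simps)
  ultimately have "1/3 * (2 * sin (t / 6) * 1) \<le>
      of_int n / of_int (1 + \<bar>2 * n\<bar>) * (cmod (1 - exp (- (\<i> * of_real (\<theta> * t)))) * (1 / \<theta>))"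
    using \<open>0 \<le> sin (t / 6)\<close> assms(1) by (intro mult_mono [of "1/3"]) auto
  also have "\<dots> = cmod (duhamel_coeff n t)"
    using assms(1) \<theta> unfolding duhamel_coeff_def \<theta>_def [symmetric] norm_mult norm_divide norm_of_int
    by simp
  finally show ?thesis
    by simp
qed

subsection \<open>Failure of the bilinear estimate\<close>

theorem theorem4p1:
  fixes s T :: real
  assumes "s < 0" and "T > 0"
  shows "\<not> (\<exists>(X :: (real \<Rightarrow> periodic_distribution) set)
              (norm_X :: (real \<Rightarrow> periodic_distribution) \<Rightarrow> real).
           normed_function_space X norm_X \<and>
           continuously_embedded_in_C_Hs T s X norm_X \<and>
           (\<exists>c\<^sub>0>0.
              (\<forall>\<phi>\<in>Hs s. restrict_time T (\<lambda>t. S t \<phi>) \<in> X \<and>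
                 norm_X (restrict_time T (\<lambda>t. S t \<phi>)) \<le> c\<^sub>0 * Hs_norm s \<phi>) \<and>
              (\<forall>u\<in>X. \<forall>v. is_duhamel T u v \<longrightarrow> v \<in> X \<and> norm_X v \<le> c\<^sub>0 * (norm_X u)\<^sup>2)))"
proof (intro notI, elim exE conjE)
  fix X :: "(real \<Rightarrow> periodic_distribution) set" and N c\<^sub>0
  assume space: "normed_function_space X N" and emb: "continuously_embedded_in_C_Hs T s X N"
    and c0: "0 < c\<^sub>0"
    and lin: "\<forall>\<phi>\<in>Hs s. restrict_time T (\<lambda>t. S t \<phi>) \<in> X \<and>
                 N (restrict_time T (\<lambda>t. S t \<phi>)) \<le> c\<^sub>0 * Hs_norm s \<phi>"
    and bil: "\<forall>u\<in>X. \<forall>v. is_duhamel T u v \<longrightarrow> v \<in> X \<and> N v \<le> c\<^sub>0 * (N u)\<^sup>2"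
  have nonneg: "0 \<le> N u" if "u \<in> X" for u
    using space that unfolding normed_function_space_def by blast
  obtain C where C: "\<And>u t. u \<in> X \<Longrightarrow> t \<in> {-T..T} \<Longrightarrow> Hs_norm s (u t) \<le> C * N u"
    using emb unfolding continuously_embedded_in_C_Hs_def by blast
  \<comment> \<open>A single time, admissible for \<open>T\<close> and at most 1 as the coefficient
    bound requires, serves all frequencies.\<close>
  define t where "t = min T 1"
  have t: "0 < t" "t \<le> 1" "t \<in> {-T..T}"
    using assms(2) by (auto simp: t_def)
  define \<delta> where "\<delta> = 2/3 * sin (t / 6)"
  have \<delta>: "0 < \<delta>"
    unfolding \<delta>_def using t pi_gt3 by (intro mult_pos_pos sin_gt_zero) auto
  define R where "R = sqrt (2 * pi)"
  have R: "0 < R"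
    by (simp add: R_def)
  \<comment> \<open>\<open>\<bar>C\<bar>\<close> comes from the embedding, one
    \<open>c\<^sub>0\<close> from the bilinear estimate, and
    \<open>c\<^sub>0\<^sup>2 * R\<^sup>2\<close> from squaring the linear one.\<close>
  define K where "K = \<bar>C\<bar> * c\<^sub>0 ^ 3 * R\<^sup>2"
  define w where "w n = (1 + (real n)\<^sup>2) powr (s / 2)" for n
  have bound: "R * 2 powr s * \<delta> \<le> K * w n" if n: "0 < n" for n :: nat
  proof -
    define u where "u = restrict_time T (\<lambda>t. S t (mode (int n) 1))"
    define v where "v = restrict_time T (\<lambda>t. mode (2 * int n) (duhamel_coeff (int n) t))"
    have "0 < 1 + (real n)\<^sup>2"
      by (simp add: add_pos_nonneg)
    then have w: "0 < w n"
      by (simp add: w_def)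
    have u: "u \<in> X" "N u \<le> c\<^sub>0 * (R * w n)"
      using lin mode_in_Hs [of "int n" 1 s]
      by (auto simp: u_def Hs_norm_mode R_def w_def)
    \<comment> \<open>The bilinear estimate is assumed only where the Duhamel integral exists; the
      explicit \<open>v\<close> makes it applicable.\<close>
    have "is_duhamel T u v"
      unfolding u_def v_def using resonance_bounds(1) [of "int n"] n
      by (intro is_duhamel_mode) auto
    with bil u(1) have v: "v \<in> X" "N v \<le> c\<^sub>0 * (N u)\<^sup>2"
      by blast+
    \<comment> \<open>Since 1 + (2n)^2 <= 4 (1 + n^2) and the exponent is negative, doubling the
      frequency costs at most the factor 2 powr s.\<close>
    have "4 powr (s / 2) * w n = (4 * (1 + (real n)\<^sup>2)) powr (s / 2)"
      unfolding w_def by (rule powr_mult [symmetric])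
    also have "\<dots> \<le> (1 + (real_of_int (2 * int n))\<^sup>2) powr (s / 2)"
      using assms(1) by (intro powr_mono2') (auto simp: add_pos_nonneg)
    finally have le: "2 powr s * w n \<le> (1 + (real_of_int (2 * int n))\<^sup>2) powr (s / 2)"
      using powr_powr [of 2 2 "s / 2"] by simp
    have "R * (2 powr s * w n) * \<delta> \<le>
        R * (1 + (real_of_int (2 * int n))\<^sup>2) powr (s / 2) * cmod (duhamel_coeff (int n) t)"
      using cmod_duhamel_coeff_ge [of "int n" t] n t R w \<delta> le
      by (intro mult_mono) (auto simp: \<delta>_def)
    also have "\<dots> = Hs_norm s (v t)"
      using t(3) by (simp add: v_def restrict_time_def Hs_norm_mode R_def)
    also have "\<dots> \<le> C * N v"
      by (rule C) (fact v(1), fact t(3))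
    also have "\<dots> \<le> \<bar>C\<bar> * (c\<^sub>0 * (c\<^sub>0 * (R * w n))\<^sup>2)"
      using v nonneg [OF u(1)] nonneg [OF v(1)] u(2) c0
      by (intro mult_mono order_trans [OF v(2)] power_mono) auto
    also have "\<dots> = K * w n * w n"
      unfolding K_def by (simp add: power2_eq_square power3_eq_cube)
    \<comment> \<open>The left side is linear in \<open>w n\<close>, the right side quadratic;
      cancelling one positive factor leaves a fixed lower bound for \<open>K * w n\<close>.\<close>
    finally have "R * 2 powr s * \<delta> * w n \<le> K * w n * w n"
      by (simp add: mult_ac)
    with w show ?thesis
      by simp
  qed
  \<comment> \<open>As s < 0, \<open>w n\<close> tends to 0, contradicting that bound.\<close>
  have "filterlim (\<lambda>n. 1 + (real n)\<^sup>2) at_top sequentially"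
    by (intro filterlim_tendsto_add_at_top [OF tendsto_const] filterlim_pow_at_top
        filterlim_real_sequentially) simp
  then have "w \<longlonglongrightarrow> 0"
    unfolding w_def [abs_def] using assms(1) by (intro tendsto_neg_powr) auto
  then have "(\<lambda>n. K * w n) \<longlonglongrightarrow> 0"
    using tendsto_mult_right_zero by blast
  moreover have "\<forall>\<^sub>F n in sequentially. R * 2 powr s * \<delta> \<le> K * w n"
    using eventually_gt_at_top [of 0] by eventually_elim (rule bound)
  ultimately have "R * 2 powr s * \<delta> \<le> 0"
    by (rule tendsto_lowerbound) simp
  moreover have "0 < R * 2 powr s * \<delta>"
    using R \<delta> by simp
  ultimately show False
    by linarith
qed

end
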